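(* Let $X$ be a metric space and let $\mathcal{I}$, $\mathcal{K}$ be ideals on a set $S$ such that the condition $\mathrm{AP}(\mathcal{I},\mathcal{K})$ holds. If a function $f\colon S\to X$ is $\mathcal{I}$-Cauchy, then it is also $\mathcal{I}^{\mathcal{K}}$-Cauchy.
   Context: An ideal on a set $S$ is a nonempty family of subsets of $S$ closed under subsets and finite unions (it is not required to be proper or to contain the singletons). Its dual filter is $\mathcal{F}(\mathcal{I})=\{S\setminus A: A\in\mathcal{I}\}$. For $M\subseteq S$, $\mathcal{K}|_M=\{A\cap M: A\in\mathcal{K}\}$ is the trace ideal on $M$. For a metric space $(X,d)$ with its metric uniformity: a map $f\colon S\to X$ is $\mathcal{I}$-Cauchy if for every entourage $U$ (equivalently, for every $U=\{(x,y): d(x,y)<\varepsilon\}$, $\varepsilon>0$) there exists $m\in S$ such that $\{n\in S: (f(n),f(m))\notin U\}\in\mathcal{I}$. A map $f\colon S\to X$ is $\mathcal{I}^{\mathcal{K}}$-Cauchy if there is $M\in\mathcal{F}(\mathcal{I})$ such that $f|_M\colon M\to X$ is $\mathcal{K}|_M$-Cauchy. Condition $\mathrm{AP}(\mathcal{I},\mathcal{K})$: for every sequence $(A_n)_{n\in\mathbb{N}}$ of pairwise disjoint sets $A_n\in\mathcal{I}$ there exists a sequence $(B_n)_{n\in\mathbb{N}}$ of sets $B_n\in\mathcal{I}$ such that $A_n\triangle B_n\in\mathcal{K}$ for each $n$ and $\bigcup_{n\in\mathbb{N}}B_n\in\mathcal{I}$. *)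

theory Defs
  imports Complex_Main "HOL-Library.Disjoint_Sets"
begin

definition set_ideal :: "'a set \<Rightarrow> 'a set set \<Rightarrow> bool" where
  "set_ideal S I \<longleftrightarrow>
     I \<subseteq> Pow S \<and> I \<noteq> {} \<and>
     (\<forall>A\<in>I. \<forall>B. B \<subseteq> A \<longrightarrow> B \<in> I) \<and>
     (\<forall>A\<in>I. \<forall>B\<in>I. A \<union> B \<in> I)"

definition dual_filter :: "'a set \<Rightarrow> 'a set set \<Rightarrow> 'a set set" where
  "dual_filter S I = {S - A | A. A \<in> I}"

definition trace_ideal :: "'a set set \<Rightarrow> 'a set \<Rightarrow> 'a set set" where
  "trace_ideal K M = {A \<inter> M | A. A \<in> K}"

text \<open>
  A map from \<open>S\<close> to a uniform space is represented by a total function of which only the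
  values on \<open>S\<close> are used. The entourages are the sets belonging to the filter
  \<^const>\<open>uniformity\<close>, which on a metric space is generated by the sets
  \<open>{(x, y). dist x y < e}\<close> with \<open>e > 0\<close>.
\<close>

definition ideal_Cauchy :: "'a set \<Rightarrow> 'a set set \<Rightarrow> ('a \<Rightarrow> 'b::uniform_space) \<Rightarrow> bool" where
  "ideal_Cauchy S I f \<longleftrightarrow>
     (\<forall>U. eventually (\<lambda>p. p \<in> U) uniformity \<longrightarrow>
        (\<exists>m\<in>S. {n \<in> S. (f n, f m) \<notin> U} \<in> I))"

text \<open>
  Below, passing the domain \<open>M\<close> to \<^const>\<open>ideal_Cauchy\<close> expresses the restriction of
  \<open>f\<close> to \<open>M\<close>.
\<close>

definition ideal_ideal_Cauchy ::
    "'a set \<Rightarrow> 'a set set \<Rightarrow> 'a set set \<Rightarrow> ('a \<Rightarrow> 'b::uniform_space) \<Rightarrow> bool" where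
  "ideal_ideal_Cauchy S I K f \<longleftrightarrow>
     (\<exists>M\<in>dual_filter S I. ideal_Cauchy M (trace_ideal K M) f)"

definition AP :: "'a set set \<Rightarrow> 'a set set \<Rightarrow> bool" where
  "AP I K \<longleftrightarrow>
     (\<forall>A :: nat \<Rightarrow> 'a set. (\<forall>n. A n \<in> I) \<longrightarrow> disjoint_family A \<longrightarrow>
        (\<exists>B :: nat \<Rightarrow> 'a set. (\<forall>n. B n \<in> I) \<and> (\<forall>n. sym_diff (A n) (B n) \<in> K) \<and>
           (\<Union>n. B n) \<in> I))"

end

theory Submission
  imports Defs
begin

text \<open>
  Being \<open>I\<close>-Cauchy provides, for each \<open>k\<close>, a set \<open>E k \<in> I\<close> outside which all values of \<open>f\<close> lie
  within \<open>1 / (k + 1)\<close> of one fixed value. A set \<open>C \<in> I\<close> that contains every \<open>E k\<close> up to an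
  error in \<open>K\<close> (lemma \<open>AP_pseudo_union\<close>) then gives the required \<open>M = S - C\<close>: on \<open>M\<close> the exceptional
  set for \<open>1 / (k + 1)\<close> is contained in \<open>E k - C\<close>, which belongs to \<open>K\<close>. Condition \<open>AP\<close> is exactly
  what produces such a \<open>C\<close>, once the \<open>E k\<close> have been made disjoint.

  The centres furnished by the hypothesis need not lie in \<open>M\<close>, so they are replaced by points of
  \<open>M - E k\<close>, at the cost of a factor \<open>2\<close> in the distance. Such points exist because
  \<open>C \<union> E k \<in> I\<close> is not all of \<open>S\<close>, provided that \<open>I\<close> is proper. If \<open>I\<close> is improper, every subset of
  \<open>S\<close> belongs to the dual filter, and a singleton \<open>M\<close> does.
\<close>

lemma set_ideal_subset: "set_ideal S I \<Longrightarrow> A \<in> I \<Longrightarrow> B \<subseteq> A \<Longrightarrow> B \<in> I"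
  unfolding set_ideal_def by blast

lemma set_ideal_Un: "set_ideal S I \<Longrightarrow> A \<in> I \<Longrightarrow> B \<in> I \<Longrightarrow> A \<union> B \<in> I"
  unfolding set_ideal_def by blast

lemma set_ideal_empty: "set_ideal S I \<Longrightarrow> {} \<in> I"
  unfolding set_ideal_def by blast

lemma set_ideal_finite_UN:
  assumes "set_ideal S I" "finite J" "\<And>j. j \<in> J \<Longrightarrow> A j \<in> I"
  shows "(\<Union>j\<in>J. A j) \<in> I"
  using assms(2,3)
  by (induction J rule: finite_induct)
    (auto intro: set_ideal_empty[OF assms(1)] set_ideal_Un[OF assms(1)])

text \<open>
  The condition \<open>AP\<close> speaks of disjoint sequences. Disjointing \<open>E\<close> is harmless because \<open>E k\<close> is
  covered by the first \<open>k + 1\<close> disjointed pieces, so that \<open>E k - C\<close> is covered by finitely many of the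
  symmetric differences.
\<close>

lemma AP_pseudo_union:
  fixes E :: "nat \<Rightarrow> 'a set"
  assumes I: "set_ideal S I" and K: "set_ideal S K" and "AP I K" and E: "\<And>k. E k \<in> I"
  shows "\<exists>C\<in>I. \<forall>k. E k - C \<in> K"
proof -
  have "disjointed E k \<in> I" for k
    using I E disjointed_subset by (rule set_ideal_subset)
  then obtain B :: "nat \<Rightarrow> 'a set"
    where B: "\<And>k. sym_diff (disjointed E k) (B k) \<in> K" "(\<Union>k. B k) \<in> I"
    using \<open>AP I K\<close> disjoint_family_disjointed[of E] unfolding AP_def by blast
  have "E k - (\<Union>j. B j) \<in> K" for k
  proof (rule set_ideal_subset[OF K])
    show "(\<Union>j\<in>{0..<Suc k}. sym_diff (disjointed E j) (B j)) \<in> K"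
      using B(1) by (intro set_ideal_finite_UN[OF K]) auto
    have "E k \<subseteq> (\<Union>j\<in>{0..<Suc k}. disjointed E j)"
      unfolding finite_UN_disjointed_eq by auto
    then show "E k - (\<Union>j. B j) \<subseteq> (\<Union>j\<in>{0..<Suc k}. sym_diff (disjointed E j) (B j))"
      by blast
  qed
  with B(2) show ?thesis by blast
qed

lemma ideal_Cauchy_metric_seq:
  fixes f :: "'a \<Rightarrow> 'b::metric_space"
  assumes "ideal_Cauchy S I f"
  shows "\<exists>m. \<forall>k::nat. {n \<in> S. \<not> dist (f n) (f (m k)) < inverse (real (Suc k))} \<in> I"
proof (intro choice allI)
  fix k :: nat
  let ?U = "{(x :: 'b, y). dist x y < inverse (real (Suc k))}"
  have "eventually (\<lambda>p. p \<in> ?U) uniformity"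
    unfolding eventually_uniformity_metric by (intro exI[of _ "inverse (real (Suc k))"]) auto
  with assms have "\<exists>m\<in>S. {n \<in> S. (f n, f m) \<notin> ?U} \<in> I"
    unfolding ideal_Cauchy_def by blast
  then show "\<exists>m. {n \<in> S. \<not> dist (f n) (f m) < inverse (real (Suc k))} \<in> I"
    by auto
qed

text \<open>
  The exceptional sets are subsets of \<open>M\<close>, and such a set is its own trace, so it is enough to find
  them in \<open>K\<close> itself.
\<close>

lemma ideal_Cauchy_trace_metricI:
  fixes f :: "'a \<Rightarrow> 'b::metric_space"
  assumes K: "set_ideal S K"
    and ex: "\<And>e. e > 0 \<Longrightarrow> \<exists>m\<in>M. {n \<in> M. \<not> dist (f n) (f m) < e} \<in> K"
  shows "ideal_Cauchy M (trace_ideal K M) f"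
  unfolding ideal_Cauchy_def
proof (intro allI impI)
  fix U :: "('b \<times> 'b) set"
  assume "eventually (\<lambda>p. p \<in> U) uniformity"
  then obtain e where "e > 0" and e: "\<And>x y. dist x y < e \<Longrightarrow> (x, y) \<in> U"
    unfolding eventually_uniformity_metric by blast
  from ex[OF \<open>e > 0\<close>] obtain m where "m \<in> M" and m: "{n \<in> M. \<not> dist (f n) (f m) < e} \<in> K"
    by blast
  have "{n \<in> M. (f n, f m) \<notin> U} \<in> K"
    using e by (intro set_ideal_subset[OF K m]) auto
  moreover have "{n \<in> M. (f n, f m) \<notin> U} = {n \<in> M. (f n, f m) \<notin> U} \<inter> M"
    by blast
  ultimately show "\<exists>m\<in>M. {n \<in> M. (f n, f m) \<notin> U} \<in> trace_ideal K M"
    using \<open>m \<in> M\<close> unfolding trace_ideal_def by blast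
qed

theorem theorem5p1:
  fixes S :: "'a set" and I K :: "'a set set" and f :: "'a \<Rightarrow> 'b::metric_space"
  assumes "set_ideal S I" and "set_ideal S K"
    and "AP I K"
    and "ideal_Cauchy S I f"
  shows "ideal_ideal_Cauchy S I K f"
proof (cases "S \<in> I")
  case True
  \<comment> \<open>The definition demands a centre in \<open>S\<close> even for the largest entourage.\<close>
  have "eventually (\<lambda>p :: 'b \<times> 'b. p \<in> UNIV) uniformity"
    by simp
  then obtain s where "s \<in> S"
    using assms(4) unfolding ideal_Cauchy_def by blast
  have "S - {s} \<in> I"
    using set_ideal_subset[OF assms(1) True] by blast
  moreover have "{s} = S - (S - {s})"
    using \<open>s \<in> S\<close> by blast
  ultimately have "{s} \<in> dual_filter S I"
    unfolding dual_filter_def by blast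
  moreover have "ideal_Cauchy {s} (trace_ideal K {s}) f"
  proof (rule ideal_Cauchy_trace_metricI[OF assms(2)])
    fix e :: real assume "e > 0"
    then have "{n \<in> {s}. \<not> dist (f n) (f s) < e} = {}" by auto
    then have "{n \<in> {s}. \<not> dist (f n) (f s) < e} \<in> K"
      using set_ideal_empty[OF assms(2)] by (simp only:)
    then show "\<exists>m\<in>{s}. {n \<in> {s}. \<not> dist (f n) (f m) < e} \<in> K"
      by blast
  qed
  ultimately show ?thesis
    unfolding ideal_ideal_Cauchy_def by blast
next
  case False
  obtain m where m: "\<forall>k::nat. {n \<in> S. \<not> dist (f n) (f (m k)) < inverse (real (Suc k))} \<in> I"
    using ideal_Cauchy_metric_seq[OF assms(4)] ..
  define E where "E k = {n \<in> S. \<not> dist (f n) (f (m k)) < inverse (real (Suc k))}" for k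
  have E: "E k \<in> I" for k
    unfolding E_def by (rule m[rule_format])
  obtain C where "C \<in> I" and C: "\<forall>k. E k - C \<in> K"
    using AP_pseudo_union[OF assms(1-3) E] ..
  have "S - C \<in> dual_filter S I"
    using \<open>C \<in> I\<close> unfolding dual_filter_def by blast
  moreover have "ideal_Cauchy (S - C) (trace_ideal K (S - C)) f"
  proof (rule ideal_Cauchy_trace_metricI[OF assms(2)])
    fix e :: real assume "e > 0"
    \<comment> \<open>Two points outside \<open>E k\<close> are compared through \<open>f (m k)\<close>, hence \<open>e / 2\<close>.\<close>
    then obtain k where k: "inverse (real (Suc k)) < e / 2"
      using reals_Archimedean[of "e / 2"] by auto
    have "\<not> S \<subseteq> C \<union> E k"
      using False set_ideal_subset[OF assms(1) set_ideal_Un[OF assms(1) \<open>C \<in> I\<close> E]] by metis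
    then obtain p where p: "p \<in> S - C" "p \<notin> E k" by blast
    have "dist (f n) (f p) < e" if "n \<in> S - C" "n \<notin> E k" for n
    proof (rule dist_triangle_half_l)
      show "dist (f n) (f (m k)) < e / 2" "dist (f p) (f (m k)) < e / 2"
        using that p k unfolding E_def by auto
    qed
    then have "{n \<in> S - C. \<not> dist (f n) (f p) < e} \<subseteq> E k - C" by blast
    then have "{n \<in> S - C. \<not> dist (f n) (f p) < e} \<in> K"
      by (rule set_ideal_subset[OF assms(2) C[rule_format]])
    with p(1) show "\<exists>p\<in>S - C. {n \<in> S - C. \<not> dist (f n) (f p) < e} \<in> K" by blast
  qed
  ultimately show ?thesis
    unfolding ideal_ideal_Cauchy_def by blast
qed

end
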